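(* For all $m>1$, the discrete Laplacian $L$ on the unweighted lattice $\mathbb{Z}$, i.e. $Lf(x)=f(x+1)+f(x-1)-2f(x)$ for $x\in\mathbb{Z}$, satisfies the condition $CD_{m,1}\big(0,\frac{1}{m-1}\big)$.
   Context: Let $X$ be a countable set and $k:X\times X\to[0,\infty)$ a nontrivial kernel with $k(x,x)=0$ such that for each $x$ only finitely many $y$ satisfy $k(x,y)>0$; put $Lf(x)=\sum_{y\in X}k(x,y)(f(y)-f(x))$. The unweighted lattice is $X=\mathbb{Z}$ with $k(x,y)=1$ if $|x-y|=1$ and $k(x,y)=0$ otherwise. For $w:X\to(0,\infty)$ and $m>1$, $$\tilde{\Psi}_\Upsilon^{(m)}(w)(x)=\sum_{y\in X}k(x,y)\Big(\tfrac{m-1}{m}w(x)^2+\tfrac{(m-1)^2}{m}w(x)^{\frac{m-2}{m-1}}w(y)^{\frac{m}{m-1}}-(m-1)w(x)w(y)\Big).$$ For $u:X\to(0,\infty)$, $m>1$ and $\alpha\in[0,1]$, $$\mathcal{D}_{m,\alpha}(u)(x)=\sum_{y\in X}k(x,y)\Big(\Big(1-\alpha+\alpha\tfrac{u(y)}{u(x)}\Big)m\,u^{m-2}(y)Lu^m(y)-\Big(m-\alpha+\alpha\big(\tfrac{u(y)}{u(x)}\big)^m\Big)u^{m-2}(x)Lu^m(x)\Big).$$ Condition $CD_{m,\alpha}(0,d)$ (with $d>0$) at $x\in X$: for every $u:X\to(0,\infty)$, with $v=\frac{m}{m-1}u^{m-1}$ and $G=Lv+\alpha\frac{\tilde{\Psi}_\Upsilon^{(m)}(v)}{(m-1)v}$,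 such that $-G(x)>0$ and $-G(x)\ge -G(y)$ for all $y\in X$ with $k(x,y)>0$, one has $$\mathcal{D}_{m,\alpha}(u)(x)\ge\frac1d\big(-G(x)\big)^2.$$ $L$ satisfies $CD_{m,\alpha}(0,d)$ if it satisfies it at every $x\in X$. *)

theory Defs
  imports Complex_Main "HOL-Library.Countable"
begin

text \<open>The underlying countable set \<open>X\<close> is the type \<open>'a\<close>.\<close>

locale locally_finite_kernel =
  fixes k :: "'a::countable \<Rightarrow> 'a \<Rightarrow> real"
  assumes nonneg: "0 \<le> k x y"
    and diag_zero: "k x x = 0"
    and finite_nbrs: "finite {y. 0 < k x y}"
    and nontrivial: "\<exists>x y. 0 < k x y"

text \<open>
  The definitions below take the kernel as an explicit argument and are meant for kernels
  satisfying \<open>locally_finite_kernel\<close>.  There the set \<open>{y. 0 < k x y}\<close> is finite and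
  all terms outside it vanish, so sums over this set are the sums over all of \<open>X\<close>.
  Powers with a real exponent are only ever taken of positive numbers.
\<close>

definition laplacian :: "('a \<Rightarrow> 'a \<Rightarrow> real) \<Rightarrow> ('a \<Rightarrow> real) \<Rightarrow> 'a \<Rightarrow> real" where
  "laplacian k f x = (\<Sum>y | 0 < k x y. k x y * (f y - f x))"

definition Psi_tilde :: "('a \<Rightarrow> 'a \<Rightarrow> real) \<Rightarrow> real \<Rightarrow> ('a \<Rightarrow> real) \<Rightarrow> 'a \<Rightarrow> real" where
  "Psi_tilde k m w x = (\<Sum>y | 0 < k x y. k x y *
     ((m - 1) / m * (w x)\<^sup>2
      + (m - 1)\<^sup>2 / m * w x powr ((m - 2) / (m - 1)) * w y powr (m / (m - 1))
      - (m - 1) * w x * w y))"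

definition D_op :: "('a \<Rightarrow> 'a \<Rightarrow> real) \<Rightarrow> real \<Rightarrow> real \<Rightarrow> ('a \<Rightarrow> real) \<Rightarrow> 'a \<Rightarrow> real" where
  "D_op k m \<alpha> u x = (\<Sum>y | 0 < k x y. k x y *
     ((1 - \<alpha> + \<alpha> * (u y / u x)) * m * u y powr (m - 2) * laplacian k (\<lambda>z. u z powr m) y
      - (m - \<alpha> + \<alpha> * (u y / u x) powr m) * u x powr (m - 2)
          * laplacian k (\<lambda>z. u z powr m) x))"

definition pressure :: "real \<Rightarrow> ('a \<Rightarrow> real) \<Rightarrow> 'a \<Rightarrow> real" where
  "pressure m u x = m / (m - 1) * u x powr (m - 1)"

definition G_op :: "('a \<Rightarrow> 'a \<Rightarrow> real) \<Rightarrow> real \<Rightarrow> real \<Rightarrow> ('a \<Rightarrow> real) \<Rightarrow> 'a \<Rightarrow> real" where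
  "G_op k m \<alpha> v x = laplacian k v x + \<alpha> * (Psi_tilde k m v x / ((m - 1) * v x))"

text \<open>
  The condition \<open>CD\<^sub>m\<^sub>,\<^sub>\<alpha>(0,d)\<close> at a point, and at all points, for parameters
  \<open>m > 1\<close>, \<open>0 \<le> \<alpha> \<le> 1\<close> and \<open>d > 0\<close>.
\<close>

definition CD0_at ::
  "('a \<Rightarrow> 'a \<Rightarrow> real) \<Rightarrow> real \<Rightarrow> real \<Rightarrow> real \<Rightarrow> 'a \<Rightarrow> bool" where
  "CD0_at k m \<alpha> d x \<longleftrightarrow>
     (\<forall>u. (\<forall>z. 0 < u z) \<longrightarrow>
        (let G = G_op k m \<alpha> (pressure m u) in
           0 < - G x \<longrightarrow> (\<forall>y. 0 < k x y \<longrightarrow> - G y \<le> - G x) \<longrightarrow>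
           1 / d * (- G x)\<^sup>2 \<le> D_op k m \<alpha> u x))"

definition CD0 :: "('a \<Rightarrow> 'a \<Rightarrow> real) \<Rightarrow> real \<Rightarrow> real \<Rightarrow> real \<Rightarrow> bool" where
  "CD0 k m \<alpha> d \<longleftrightarrow> (\<forall>x. CD0_at k m \<alpha> d x)"

definition lattice_kernel :: "int \<Rightarrow> int \<Rightarrow> real" where
  "lattice_kernel x y = (if \<bar>x - y\<bar> = 1 then 1 else 0)"

lemma lattice_nbrs: "{y. 0 < lattice_kernel x y} = {x + 1, x - 1}"
  by (auto simp: lattice_kernel_def)

lemma locally_finite_kernel_lattice: "locally_finite_kernel lattice_kernel"
proof
  show "\<exists>x y. 0 < lattice_kernel x y"
    by (rule exI[of _ 0], rule exI[of _ 1]) (simp add: lattice_kernel_def)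
qed (simp_all add: lattice_nbrs, simp_all add: lattice_kernel_def)

lemma laplacian_lattice:
  "laplacian lattice_kernel f x = f (x + 1) + f (x - 1) - 2 * f x"
  unfolding laplacian_def lattice_nbrs by (simp add: lattice_kernel_def)

end

theory Submission imports Defs begin

text \<open>
  For \<open>\<alpha> = 1\<close> the quantity \<open>G\<close> collapses to \<open>G = L u\<^sup>m / u\<close>.  Substituting
  \<open>L u\<^sup>m = u G\<close> in \<open>\<D>\<^bsub>m,1\<^esub>(u)(x)\<close> and using \<open>G(y) \<ge> G(x)\<close> for the neighbours \<open>y\<close> of \<open>x\<close>,
  the sum is at least \<open>(m - 1) G(x) L u\<^sup>m(x) / u(x) = (m - 1) G(x)\<^sup>2\<close>.
\<close>

lemma pressure_pos: "m > 1 \<Longrightarrow> 0 < u x \<Longrightarrow> 0 < pressure m u x"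
  by (simp add: pressure_def)

text \<open>This is the mixed term of \<open>Psi_tilde\<close> at the pressure. The two exponents
  add up to 2, so the constant \<open>m / (m - 1)\<close> enters squared; one copy together with
  \<open>u x powr (m - 1)\<close> rebuilds the pressure at \<open>x\<close>.\<close>

lemma pressure_powr_product:
  assumes m: "m > 1" and "0 < u x" "0 < u y"
  shows "pressure m u x powr ((m - 2) / (m - 1)) * pressure m u y powr (m / (m - 1))
         = m / (m - 1) * pressure m u x * (u y powr m / u x)"
proof -
  define c where "c = m / (m - 1)"
  have c: "c > 0" using m by (simp add: c_def)
  have "(m - 2) / (m - 1) + m / (m - 1) = 2"
    using m by (simp add: divide_eq_eq flip: add_divide_distrib)
  then have e: "(m - 2) / (m - 1) + m / (m - 1) = 2" "(m - 1) * ((m - 2) / (m - 1)) = m - 2"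
    "(m - 1) * c = m"
    using m by (simp_all add: c_def)
  have "pressure m u x powr ((m - 2) / (m - 1)) * pressure m u y powr (m / (m - 1))
      = (c powr ((m - 2) / (m - 1)) * c powr (m / (m - 1))) * (u x powr (m - 2) * u y powr m)"
    using m c by (simp add: pressure_def powr_mult powr_powr e(2,3) flip: c_def)
  also have "c powr ((m - 2) / (m - 1)) * c powr (m / (m - 1)) = c * c"
    using c by (simp add: e(1) power2_eq_square flip: powr_add)
  also have "u x powr (m - 2) = u x powr (m - 1) / u x"
    using assms(2) powr_diff[of "u x" "m - 1" 1] by simp
  finally show ?thesis
    by (simp add: pressure_def c_def)
qed

text \<open>The identity holds summand by summand: the mixed term of \<open>Psi_tilde\<close> yields
  \<open>u y powr m / u x\<close>, and the remaining terms collapse to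
  \<open>- (u x powr m / u x)\<close>.\<close>

lemma G_op_pressure:
  assumes m: "m > 1" and u: "\<And>z. 0 < u z"
  shows "G_op k m 1 (pressure m u) x = laplacian k (\<lambda>z. u z powr m) x / u x"
proof -
  define p where "p = pressure m u x"
  have p: "p > 0" using pressure_pos[of m u x] m u by (simp add: p_def)
  have um: "u x powr (m - 1) = u x powr m / u x"
    using u[of x] by (simp add: powr_diff)
  have px: "(m - 1) / m * p = u x powr m / u x"
    using m by (simp add: p_def pressure_def um)
  have summand: "k x y * (pressure m u y - p)
      + k x y * ((m - 1) / m * p\<^sup>2
         + (m - 1)\<^sup>2 / m * p powr ((m - 2) / (m - 1)) * pressure m u y powr (m / (m - 1))
         - (m - 1) * p * pressure m u y) / ((m - 1) * p)
      = k x y * (u y powr m - u x powr m) / u x" (is "?l = _") for y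
  proof -
    define q where "q = pressure m u y"
    define r where "r = u y powr m / u x"
    have pq: "(m - 1)\<^sup>2 / m * p powr ((m - 2) / (m - 1)) * q powr (m / (m - 1)) = (m - 1) * p * r"
    proof -
      have "(m - 1)\<^sup>2 / m * (p powr ((m - 2) / (m - 1)) * q powr (m / (m - 1)))
          = (m - 1)\<^sup>2 / m * (m / (m - 1) * p * r)"
        unfolding p_def q_def r_def by (simp only: pressure_powr_product[of m u x y, OF m u u])
      then show ?thesis
        using m by (simp add: power2_eq_square mult.assoc)
    qed
    have "?l = k x y * (q - p + ((m - 1) / m * p\<^sup>2 + (m - 1) * p * r - (m - 1) * p * q)
                               / ((m - 1) * p))"
      unfolding q_def[symmetric] pq by (simp add: algebra_simps)
    \<comment> \<open>The cross term contributes \<open>- q\<close> and cancels the pressure at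
      \<open>y\<close>; the square contributes \<open>p / m\<close>, which turns \<open>- p\<close>
      into \<open>- (m - 1) / m * p\<close>.\<close>
    also have "\<dots> = k x y * (r - (m - 1) / m * p)"
      using m p by (simp add: field_simps power2_eq_square)
    also have "\<dots> = k x y * (u y powr m - u x powr m) / u x"
      unfolding px by (simp add: r_def flip: diff_divide_distrib)
    finally show ?thesis .
  qed
  show ?thesis
    unfolding G_op_def laplacian_def Psi_tilde_def
    by (simp only: mult_1 sum_divide_distrib summand flip: p_def sum.distrib)
qed

text \<open>The estimate is made edge by edge, so it is stated for a general kernel and the lattice
  is an instance.\<close>

theorem CD0_alpha_1:
  fixes k :: "'a \<Rightarrow> 'a \<Rightarrow> real"
  assumes m: "m > 1"
  shows "CD0 k m 1 (1 / (m - 1))"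
  unfolding CD0_def CD0_at_def Let_def
proof (intro allI impI)
  fix u :: "'a \<Rightarrow> real" and x
  assume pos: "\<forall>z. 0 < u z"
  define G where "G = G_op k m 1 (pressure m u)"
  assume "0 < - G_op k m 1 (pressure m u) x"
    and max: "\<forall>y. 0 < k x y \<longrightarrow> - G_op k m 1 (pressure m u) y \<le> - G_op k m 1 (pressure m u) x"
  have u: "0 < u z" for z using pos by simp
  have L: "laplacian k (\<lambda>z. u z powr m) y = u y * G y" for y
    using u[of y] by (simp add: G_def G_op_pressure[OF m u])
  have split: "u y powr (m - 2) * u y = u y powr m / u y" for y
    using u[of y] by (simp add: powr_diff power2_eq_square)
  \<comment> \<open>One factor \<open>G x\<close> is turned back into a Laplacian, so that both
    sides become sums over the neighbours of \<open>x\<close>.\<close>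
  have "(m - 1) * (G x)\<^sup>2
      = (m - 1) * G x / u x * laplacian k (\<lambda>z. u z powr m) x"
    using u[of x] by (simp add: L power2_eq_square)
  also have "\<dots> = (\<Sum>y | 0 < k x y. k x y * ((m - 1) * G x / u x * (u y powr m - u x powr m)))"
    unfolding laplacian_def sum_distrib_left by (simp add: mult_ac)
  also have "\<dots> \<le> D_op k m 1 u x"
    unfolding D_op_def L
  proof (rule sum_mono)
    fix y assume "y \<in> {y. 0 < k x y}"
    then have k: "0 < k x y" and "G x \<le> G y"
      using max by (auto simp: G_def)
    \<comment> \<open>Since \<open>(u y / u x) powr m * u x powr m = u y powr m\<close>, one of the
      \<open>m\<close> copies of \<open>u y powr m\<close> cancels.\<close>
    have "(m - 1) * G x / u x * (u y powr m - u x powr m)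
        = m * u y powr m / u x * G x - (m - 1 + (u y / u x) powr m) * (u x powr m / u x) * G x"
      using u[of x] u[of y] by (simp add: powr_divide field_simps)
    \<comment> \<open>The coefficient of \<open>G y\<close> is positive, so replacing
      \<open>G x\<close> by \<open>G y\<close> can only increase the expression.\<close>
    also have "\<dots> \<le> m * u y powr m / u x * G y
        - (m - 1 + (u y / u x) powr m) * (u x powr m / u x) * G x"
      using m u[of x] \<open>G x \<le> G y\<close> by (intro diff_right_mono mult_left_mono) auto
    \<comment> \<open>The unsimplified form is the summand of \<open>D_op\<close> at \<alpha> = 1,
      as \<open>sum_mono\<close> presents it.\<close>
    also have "\<dots> = (1 - 1 + 1 * (u y / u x)) * m * u y powr (m - 2) * (u y * G y)
        - (m - 1 + 1 * (u y / u x) powr m) * u x powr (m - 2) * (u x * G x)"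
    proof -
      have "(1 - 1 + 1 * (u y / u x)) * m * u y powr (m - 2) * (u y * G y)
          = m * (u y / u x) * (u y powr (m - 2) * u y) * G y" by simp
      also have "\<dots> = m * u y powr m / u x * G y"
        unfolding split using u[of y] by simp
      finally have "(1 - 1 + 1 * (u y / u x)) * m * u y powr (m - 2) * (u y * G y)
          = m * u y powr m / u x * G y" .
      moreover have "(m - 1 + 1 * (u y / u x) powr m) * u x powr (m - 2) * (u x * G x)
          = (m - 1 + (u y / u x) powr m) * (u x powr (m - 2) * u x) * G x" by simp
      ultimately show ?thesis
        by (simp only: split)
    qed
    finally show "k x y * ((m - 1) * G x / u x * (u y powr m - u x powr m))
        \<le> k x y * ((1 - 1 + 1 * (u y / u x)) * m * u y powr (m - 2) * (u y * G y)
        - (m - 1 + 1 * (u y / u x) powr m) * u x powr (m - 2) * (u x * G x))"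
      using k by (intro mult_left_mono) auto
  qed
  finally show "1 / (1 / (m - 1)) * (- G_op k m 1 (pressure m u) x)\<^sup>2 \<le> D_op k m 1 u x"
    by (simp add: G_def)
qed

theorem theorem4p8:
  fixes m :: real
  assumes "m > 1"
  shows "CD0 lattice_kernel m 1 (1 / (m - 1))"
  using assms by (rule CD0_alpha_1)

end
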